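(* Let $\mathcal{D}$ be one of the step sets $\{(0,1),(1,0),(-1,-1),(0,-1)\}$, $\{(0,1),(1,0),(-1,-1),(1,-1)\}$, $\{(0,1),(-1,0),(1,0),(1,-1)\}$, $\{(0,1),(1,0),(-1,-1),(0,-1),(1,-1)\}$, $\{(-1,1),(0,1),(1,0),(0,-1),(1,-1)\}$, and let $0<t<1/|\mathcal{D}|$ be transcendental over $\mathbb{Q}$ and such that $G_t$ is infinite. Then for $i=1$ (and for $i=2$) there exist an integer $n\ge0$, $c_0,\dots,c_{n-1}\in\mathbb{C}$ and $g\in\mathbb{C}(\overline{E_t})$ such that $\delta^n(b_i)+c_{n-1}\delta^{n-1}(b_i)+\cdots+c_1\delta(b_i)+c_0b_i=\tau(g)-g$.
   Context: Let $d_{i,j}=1$ if $(i,j)\in\mathcal{D}$, else $0$. $\overline{E_t}\subset\mathbb{P}^1(\mathbb{C})\times\mathbb{P}^1(\mathbb{C})$ is the curve $x_0x_1y_0y_1-t\sum_{i,j=0}^2d_{i-1,j-1}x_0^ix_1^{2-i}y_0^jy_1^{2-j}=0$ (an elliptic curve here), with function field $\mathbb{C}(\overline{E_t})$ and coordinate functions $x=x_0/x_1$, $y=y_0/y_1$. $\iota_1,\iota_2$ are the involutions of $\overline{E_t}$ exchanging the two points of each fibre of the first, resp. second, projection; $\tau=\iota_2\circ\iota_1$; $G_t=\langle\iota_1,\iota_2\rangle$. For $f\in\mathbb{C}(\overline{E_t})$ and an automorphism $\sigma$, $\sigma(f)=f\circ\sigma$. Set $b_1=\iota_1(y)(\tau(x)-x)$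 and $b_2=x(\iota_1(y)-y)$. Fix a nonzero regular differential $\Omega$ on $\overline{E_t}$ and let $\delta$ be the derivation with $df=\delta(f)\Omega$. *)

theory Defs
  imports "HOL-Computational_Algebra.Polynomial" "HOL-Algebra.Generated_Groups" "HOL-Algebra.Bij"
    "HOL-Algebra.Ring"
begin

section \<open>Curves in the product of two projective lines\<close>

definition proj_rel :: "complex \<times> complex \<Rightarrow> complex \<times> complex \<Rightarrow> bool" where
  "proj_rel u v \<longleftrightarrow> u \<noteq> (0, 0) \<and> (\<exists>c. c \<noteq> 0 \<and> v = (c * fst u, c * snd u))"

lemma part_equivp_proj_rel: "part_equivp proj_rel"
proof (rule part_equivpI)
  show "\<exists>u. proj_rel u u"
    by (rule exI[of _ "(1, 1)"]) (auto simp: proj_rel_def)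
  show "symp proj_rel"
  proof (rule sympI)
    fix u v assume "proj_rel u v"
    then obtain c where "u \<noteq> (0, 0)" "c \<noteq> 0" "v = (c * fst u, c * snd u)"
      unfolding proj_rel_def by blast
    then show "proj_rel v u"
      by (cases u) (auto simp: proj_rel_def intro!: exI[of _ "inverse c"])
  qed
  show "transp proj_rel"
  proof (rule transpI)
    fix u v w assume "proj_rel u v" "proj_rel v w"
    then obtain c d where "u \<noteq> (0, 0)" "c \<noteq> 0" "d \<noteq> 0"
      "v = (c * fst u, c * snd u)" "w = (d * fst v, d * snd v)"
      unfolding proj_rel_def by blast
    then show "proj_rel u w"
      by (auto simp: proj_rel_def intro!: exI[of _ "d * c"])
  qed
qed

quotient_type proj_line = "complex \<times> complex" / partial: proj_rel
  by (rule part_equivp_proj_rel)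

type_synonym point = "proj_line \<times> proj_line"

text \<open>Bihomogeneous forms of bidegree \<open>(m, n)\<close> on pairs of homogeneous coordinate vectors
  \<open>u = (x\<^sub>0, x\<^sub>1)\<close>, \<open>v = (y\<^sub>0, y\<^sub>1)\<close>.\<close>

definition biform ::
  "nat \<Rightarrow> nat \<Rightarrow> (nat \<Rightarrow> nat \<Rightarrow> complex) \<Rightarrow> complex \<times> complex \<Rightarrow> complex \<times> complex \<Rightarrow> complex" where
  "biform m n a u v =
     (\<Sum>i\<le>m. \<Sum>j\<le>n. a i j * fst u ^ i * snd u ^ (m - i) * fst v ^ j * snd v ^ (n - j))"

lemma biform_scale:
  "biform m n a (c * fst u, c * snd u) (d * fst v, d * snd v) = c ^ m * d ^ n * biform m n a u v"
proof -
  have "a i j * (c * fst u) ^ i * (c * snd u) ^ (m - i) * (d * fst v) ^ j * (d * snd v) ^ (n - j)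
      = c ^ m * d ^ n * (a i j * fst u ^ i * snd u ^ (m - i) * fst v ^ j * snd v ^ (n - j))"
    if "i \<le> m" "j \<le> n" for i j
  proof -
    have "c ^ m = c ^ i * c ^ (m - i)" "d ^ n = d ^ j * d ^ (n - j)"
      using that by (simp_all flip: power_add)
    then show ?thesis by (simp only: power_mult_distrib mult_ac)
  qed
  then show ?thesis
    unfolding biform_def sum_distrib_left fst_conv snd_conv
    by (intro sum.cong refl) auto
qed

lemma biform_proj_rel:
  assumes "proj_rel u u'" "proj_rel v v'"
  obtains c d where "c \<noteq> 0" "d \<noteq> 0"
    "\<And>m n a. biform m n a u' v' = c ^ m * d ^ n * biform m n a u v"
  using assms unfolding proj_rel_def by (metis biform_scale)

lift_definition vanishes :: "nat \<Rightarrow> nat \<Rightarrow> (nat \<Rightarrow> nat \<Rightarrow> complex) \<Rightarrow> proj_line \<Rightarrow> proj_line \<Rightarrow> bool"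
  is "\<lambda>m n a u v. biform m n a u v = 0"
  by (erule (1) biform_proj_rel) simp

text \<open>The quotient of two forms of the same bidegree; its value is the default \<open>0\<close> where the
  denominator vanishes.\<close>

lift_definition biquot ::
  "nat \<Rightarrow> nat \<Rightarrow> (nat \<Rightarrow> nat \<Rightarrow> complex) \<Rightarrow> (nat \<Rightarrow> nat \<Rightarrow> complex) \<Rightarrow> proj_line \<Rightarrow> proj_line \<Rightarrow> complex"
  is "\<lambda>m n a b u v. biform m n a u v / biform m n b u v"
  by (erule (1) biform_proj_rel) simp

lift_definition affine_coord :: "proj_line \<Rightarrow> complex" is "\<lambda>u. fst u / snd u"
  by (auto simp: proj_rel_def)

definition step_weight :: "(int \<times> int) set \<Rightarrow> int \<Rightarrow> int \<Rightarrow> complex" where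
  "step_weight D i j = (if (i, j) \<in> D then 1 else 0)"

lift_definition on_curve :: "(int \<times> int) set \<Rightarrow> real \<Rightarrow> proj_line \<Rightarrow> proj_line \<Rightarrow> bool"
  is "\<lambda>D t u v. fst u * snd u * fst v * snd v - complex_of_real t *
        (\<Sum>i\<le>2. \<Sum>j\<le>2. step_weight D (int i - 1) (int j - 1) *
            fst u ^ i * snd u ^ (2 - i) * fst v ^ j * snd v ^ (2 - j)) = 0"
proof -
  fix D :: "(int \<times> int) set" and t :: real and u u' v v' :: "complex \<times> complex"
  let ?b = "biform 2 2 (\<lambda>i j. step_weight D (int i - 1) (int j - 1))"
  let ?K = "\<lambda>u v. fst u * snd u * fst v * snd v - complex_of_real t * ?b u v"
  assume "proj_rel u u'" "proj_rel v v'"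
  then obtain c d where c: "c \<noteq> 0" "u' = (c * fst u, c * snd u)"
    and d: "d \<noteq> 0" "v' = (d * fst v, d * snd v)"
    unfolding proj_rel_def by blast
  have "?K u' v' = c ^ 2 * d ^ 2 * ?K u v"
    unfolding c(2) d(2) biform_scale by (simp add: power2_eq_square algebra_simps)
  then have "(?K u v = 0) = (?K u' v' = 0)"
    using c(1) d(1) by simp
  then show "(fst u * snd u * fst v * snd v - complex_of_real t *
        (\<Sum>i\<le>2. \<Sum>j\<le>2. step_weight D (int i - 1) (int j - 1) *
            fst u ^ i * snd u ^ (2 - i) * fst v ^ j * snd v ^ (2 - j)) = 0) =
      (fst u' * snd u' * fst v' * snd v' - complex_of_real t *
        (\<Sum>i\<le>2. \<Sum>j\<le>2. step_weight D (int i - 1) (int j - 1) *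
            fst u' ^ i * snd u' ^ (2 - i) * fst v' ^ j * snd v' ^ (2 - j)) = 0)"
    unfolding biform_def .
qed

definition curve :: "(int \<times> int) set \<Rightarrow> real \<Rightarrow> point set" where
  "curve D t = {p. on_curve D t (fst p) (snd p)}"


section \<open>The function field\<close>

text \<open>The proper closed subsets of an irreducible curve are its finite subsets.  Hence a rational
  function is an equivalence class of functions under equality at all but finitely many points of
  the curve, and a form that does not vanish identically on the curve is one with finitely many
  zeros there.\<close>

type_synonym ratfun = "(point \<Rightarrow> complex) set"

definition fun_class :: "point set \<Rightarrow> (point \<Rightarrow> complex) \<Rightarrow> ratfun" where
  "fun_class E f = {g. finite {p \<in> E. g p \<noteq> f p}}"

definition function_field :: "point set \<Rightarrow> ratfun ring" where
  "function_field E =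
     \<lparr>carrier = {fun_class E (\<lambda>p. biquot m n a b (fst p) (snd p)) | m n a b.
                   finite {p \<in> E. vanishes m n b (fst p) (snd p)}},
      mult = (\<lambda>A B. \<Union>f\<in>A. \<Union>g\<in>B. fun_class E (\<lambda>p. f p * g p)),
      one = fun_class E (\<lambda>_. 1),
      zero = fun_class E (\<lambda>_. 0),
      add = (\<lambda>A B. \<Union>f\<in>A. \<Union>g\<in>B. fun_class E (\<lambda>p. f p + g p))\<rparr>"

definition const_fun :: "point set \<Rightarrow> complex \<Rightarrow> ratfun" where
  "const_fun E c = fun_class E (\<lambda>_. c)"

definition x_fun :: "point set \<Rightarrow> ratfun" where
  "x_fun E = fun_class E (\<lambda>p. affine_coord (fst p))"

definition y_fun :: "point set \<Rightarrow> ratfun" where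
  "y_fun E = fun_class E (\<lambda>p. affine_coord (snd p))"

text \<open>The action \<open>f \<mapsto> f \<circ> \<sigma>\<close> of an automorphism \<open>\<sigma>\<close> of the curve.\<close>

definition pullback :: "point set \<Rightarrow> (point \<Rightarrow> point) \<Rightarrow> ratfun \<Rightarrow> ratfun" where
  "pullback E \<sigma> A = (\<Union>f\<in>A. fun_class E (f \<circ> \<sigma>))"

definition local_ring :: "point set \<Rightarrow> point \<Rightarrow> ratfun set" where
  "local_ring E p = {fun_class E (\<lambda>q. biquot m n a b (fst q) (snd q)) | m n a b.
      finite {q \<in> E. vanishes m n b (fst q) (snd q)} \<and> \<not> vanishes m n b (fst p) (snd p)}"


section \<open>Derivations and differentials\<close>

text \<open>Complex-linear derivations of the function field, extensional outside its carrier.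
  Linearity over the complex numbers follows from additivity, the Leibniz rule and the
  vanishing on constants.\<close>

definition derivations :: "point set \<Rightarrow> (ratfun \<Rightarrow> ratfun) set" where
  "derivations E = (let F = function_field E in
     {\<delta> \<in> carrier F \<rightarrow>\<^sub>E carrier F.
        (\<forall>f\<in>carrier F. \<forall>g\<in>carrier F. \<delta> (f \<oplus>\<^bsub>F\<^esub> g) = \<delta> f \<oplus>\<^bsub>F\<^esub> \<delta> g) \<and>
        (\<forall>f\<in>carrier F. \<forall>g\<in>carrier F.
           \<delta> (f \<otimes>\<^bsub>F\<^esub> g) = (f \<otimes>\<^bsub>F\<^esub> \<delta> g) \<oplus>\<^bsub>F\<^esub> (g \<otimes>\<^bsub>F\<^esub> \<delta> f)) \<and>
        (\<forall>c. \<delta> (const_fun E c) = \<zero>\<^bsub>F\<^esub>)})"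

text \<open>Rational differentials are the linear functionals, over the function field, on the space of
  derivations.  For the function field of a complex curve the space of Kaehler differentials is
  one-dimensional, so it is its own double dual; \<open>df\<close> is the functional \<open>\<delta> \<mapsto> \<delta> f\<close>.\<close>

definition differentials :: "point set \<Rightarrow> ((ratfun \<Rightarrow> ratfun) \<Rightarrow> ratfun) set" where
  "differentials E = (let F = function_field E in
     {\<omega> \<in> derivations E \<rightarrow>\<^sub>E carrier F.
        (\<forall>\<delta>\<^sub>1\<in>derivations E. \<forall>\<delta>\<^sub>2\<in>derivations E.
           \<omega> (\<lambda>f\<in>carrier F. \<delta>\<^sub>1 f \<oplus>\<^bsub>F\<^esub> \<delta>\<^sub>2 f) = \<omega> \<delta>\<^sub>1 \<oplus>\<^bsub>F\<^esub> \<omega> \<delta>\<^sub>2) \<and>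
        (\<forall>h\<in>carrier F. \<forall>\<delta>\<in>derivations E.
           \<omega> (\<lambda>f\<in>carrier F. h \<otimes>\<^bsub>F\<^esub> \<delta> f) = h \<otimes>\<^bsub>F\<^esub> \<omega> \<delta>)})"

definition zero_diff :: "point set \<Rightarrow> (ratfun \<Rightarrow> ratfun) \<Rightarrow> ratfun" where
  "zero_diff E = (\<lambda>\<delta>\<in>derivations E. \<zero>\<^bsub>function_field E\<^esub>)"

definition exact_diff :: "point set \<Rightarrow> ratfun \<Rightarrow> (ratfun \<Rightarrow> ratfun) \<Rightarrow> ratfun" where
  "exact_diff E f = (\<lambda>\<delta>\<in>derivations E. \<delta> f)"

definition scale_diff ::
  "point set \<Rightarrow> ratfun \<Rightarrow> ((ratfun \<Rightarrow> ratfun) \<Rightarrow> ratfun) \<Rightarrow> (ratfun \<Rightarrow> ratfun) \<Rightarrow> ratfun" where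
  "scale_diff E h \<omega> = (\<lambda>\<delta>\<in>derivations E. h \<otimes>\<^bsub>function_field E\<^esub> \<omega> \<delta>)"

text \<open>A differential is regular if at every point \<open>p\<close> it can be written as a finite sum
  \<open>\<Sum> f\<^sub>i dg\<^sub>i\<close> with \<open>f\<^sub>i\<close>, \<open>g\<^sub>i\<close> in the local ring at \<open>p\<close>.\<close>

definition regular_differentials :: "point set \<Rightarrow> ((ratfun \<Rightarrow> ratfun) \<Rightarrow> ratfun) set" where
  "regular_differentials E = (let F = function_field E in
     {\<omega> \<in> differentials E. \<forall>p\<in>E. \<exists>(k::nat) f g.
        (\<forall>i<k. f i \<in> local_ring E p \<and> g i \<in> local_ring E p) \<and>
        \<omega> = (\<lambda>\<delta>\<in>derivations E. \<Oplus>\<^bsub>F\<^esub>i\<in>{..<k}. scale_diff E (f i) (exact_diff E (g i)) \<delta>)})"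


section \<open>The group of the walk\<close>

text \<open>At a ramification point the fibre is a singleton, so that \<open>q = p\<close>.\<close>

definition iota1 :: "point set \<Rightarrow> point \<Rightarrow> point" where
  "iota1 E = (\<lambda>p\<in>E. THE q. {r \<in> E. fst r = fst p} = {p, q})"

definition iota2 :: "point set \<Rightarrow> point \<Rightarrow> point" where
  "iota2 E = (\<lambda>p\<in>E. THE q. {r \<in> E. snd r = snd p} = {p, q})"

definition tau :: "point set \<Rightarrow> point \<Rightarrow> point" where
  "tau E = compose E (iota2 E) (iota1 E)"

definition walk_group :: "point set \<Rightarrow> (point \<Rightarrow> point) set" where
  "walk_group E = generate (BijGroup E) {iota1 E, iota2 E}"

definition b1 :: "point set \<Rightarrow> ratfun" where
  "b1 E = (let F = function_field E in
     pullback E (iota1 E) (y_fun E) \<otimes>\<^bsub>F\<^esub> (pullback E (tau E) (x_fun E) \<ominus>\<^bsub>F\<^esub> x_fun E))"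

definition b2 :: "point set \<Rightarrow> ratfun" where
  "b2 E = (let F = function_field E in
     x_fun E \<otimes>\<^bsub>F\<^esub> (pullback E (iota1 E) (y_fun E) \<ominus>\<^bsub>F\<^esub> y_fun E))"

end

theory Submission
  imports Defs
begin

text \<open>For each of the five step sets the coordinate functions are decoupled on the curve: there are
  univariate rational functions \<open>R\<^sub>1\<close>, \<open>R\<^sub>2\<close> with \<open>x y = R\<^sub>1(x) + R\<^sub>2(y)\<close>.  Since \<open>\<iota>\<^sub>1\<close> preserves \<open>x\<close>
  and \<open>\<iota>\<^sub>2\<close> preserves \<open>y\<close>, comparing this identity at a point and at its image gives
  \<open>b\<^sub>1 = \<tau>(R\<^sub>1(x)) - R\<^sub>1(x)\<close> and \<open>b\<^sub>2 = \<tau>(R\<^sub>2(y)) - R\<^sub>2(y)\<close>, so \<open>n = 0\<close> suffices.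

  For the first, second and fourth step set, the identity is the equation of the curve divided by
  \<open>t x\<close>.  For the other two, the roots \<open>y\<^sub>1\<close>, \<open>y\<^sub>2\<close> of the equation over a given \<open>x\<close> have product \<open>x\<close>, and
  \<open>R\<^sub>2\<close> is found among the Laurent polynomials with poles of order at most 2 by solving
  \<open>y\<^sub>1 y\<^sub>2 (y\<^sub>1 - y\<^sub>2) = R\<^sub>2(y\<^sub>1) - R\<^sub>2(y\<^sub>2)\<close>.\<close>

section \<open>Points of the projective line\<close>

lemma proj_line_cases:
  obtains V where "V \<noteq> (0, 0)" "v = abs_proj_line V"
  using Quotient_rep_reflp[OF Quotient_proj_line, of v] Quotient_abs_rep[OF Quotient_proj_line, of v]
  unfolding proj_rel_def by metis

lemma proj_rel_refl: "V \<noteq> (0, 0) \<Longrightarrow> proj_rel V V"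
  by (cases V) (auto simp: proj_rel_def intro!: exI[of _ 1])

text \<open>The scaling factor is a ratio of nonzero coordinates of the two vectors, so the
  vanishing of their determinant already makes them proportional.\<close>

lemma abs_proj_line_eq_iff:
  assumes "V \<noteq> (0, 0)" "W \<noteq> (0, 0)"
  shows "abs_proj_line V = abs_proj_line W \<longleftrightarrow> fst V * snd W = snd V * fst W"
proof -
  have "proj_rel V W \<longleftrightarrow> fst V * snd W = snd V * fst W"
  proof
    assume eq: "fst V * snd W = snd V * fst W"
    show "proj_rel V W"
    proof (cases "fst V = 0")
      case True
      then have "snd V \<noteq> 0" "fst W = 0" "snd W \<noteq> 0" using assms eq by (auto simp: prod_eq_iff)
      then show ?thesis using True assms
        by (auto simp: proj_rel_def prod_eq_iff intro!: exI[of _ "snd W / snd V"])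
    next
      case False
      then have "fst W \<noteq> 0" using assms eq by (auto simp: prod_eq_iff)
      then show ?thesis using False assms eq
        by (auto simp: proj_rel_def prod_eq_iff field_simps intro!: exI[of _ "fst W / fst V"])
    qed
  qed (auto simp: proj_rel_def)
  then show ?thesis
    using Quotient_rel[OF Quotient_proj_line, of V W] assms proj_rel_refl by blast
qed

lemma affine_coord_abs: "V \<noteq> (0, 0) \<Longrightarrow> affine_coord (abs_proj_line V) = fst V / snd V"
  by (simp add: affine_coord.abs_eq eq_onp_def proj_rel_refl)

lemma eq_affine_point:
  assumes "u \<noteq> abs_proj_line (1, 0)"
  shows "u = abs_proj_line (affine_coord u, 1)"
proof -
  obtain U where U: "U \<noteq> (0, 0)" "u = abs_proj_line U" by (rule proj_line_cases)
  then have "snd U \<noteq> 0" using assms by (auto simp: abs_proj_line_eq_iff)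
  then show ?thesis using U by (simp add: affine_coord_abs abs_proj_line_eq_iff)
qed

text \<open>Division by zero yields 0, so \<open>affine_coord\<close> is 0 at infinity as well; a
  nonzero value therefore excludes the point at infinity.\<close>

lemma eq_affine_point_nonzero:
  "affine_coord u \<noteq> 0 \<Longrightarrow> u = abs_proj_line (affine_coord u, 1)"
  by (metis eq_affine_point affine_coord_abs div_by_0 prod.inject snd_conv zero_neq_one)

lemma finite_affine_coord_in:
  assumes "finite S"
  shows "finite {u. affine_coord u \<in> S}"
proof (rule finite_subset)
  show "{u. affine_coord u \<in> S} \<subseteq> insert (abs_proj_line (1, 0)) ((\<lambda>a. abs_proj_line (a, 1)) ` S)"
    using eq_affine_point by blast
qed (use assms in simp)

text \<open>A zero (a : b) of the form splits off the linear factor b X - a Y. The cofactor m X + n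
  Y is linear too and vanishes exactly at w = (-n : m), where w = v for a double zero. The predicate
  \<open>P\<close> lets the lemma serve the fibres of both projections.\<close>

lemma binary_quadratic_zeros:
  fixes A B C :: complex
  assumes P: "\<And>V. V \<noteq> (0, 0) \<Longrightarrow>
      P (abs_proj_line V) \<longleftrightarrow> A * fst V ^ 2 + B * fst V * snd V + C * snd V ^ 2 = 0"
    and nz: "A \<noteq> 0 \<or> B \<noteq> 0 \<or> C \<noteq> 0" and v: "P v"
  shows "\<exists>w. {z. P z} = {v, w}"
proof -
  obtain V where V: "V \<noteq> (0, 0)" "v = abs_proj_line V" by (rule proj_line_cases)
  define a b where "a = fst V" and "b = snd V"
  have ab: "a \<noteq> 0 \<or> b \<noteq> 0" using V by (auto simp: a_def b_def prod_eq_iff)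
  have root: "A * a^2 + B * a * b + C * b^2 = 0" using P V v by (simp add: a_def b_def)
  \<comment> \<open>Coefficient comparison in (b X - a Y)(m X + n Y). If b = 0, the equations for
    \<open>B\<close> and \<open>C\<close> determine m and n; otherwise those for \<open>A\<close>
    and \<open>B\<close> do, and the equation for \<open>C\<close> is the assumption that (a : b) is
    a zero.\<close>
  obtain m n where fac: "A = b * m" "B = b * n - a * m" "C = - a * n"
  proof (cases "b = 0")
    case True
    then have "a \<noteq> 0" "A = 0" using ab root by auto
    then show ?thesis using True by (intro that[of "- B / a" "- C / a"]) auto
  next
    case False
    have "C = - a * ((B + a * (A / b)) / b)" using False root
      by (simp add: field_simps power2_eq_square) (simp add: eq_neg_iff_add_eq_0 ac_simps)
    then show ?thesis using False by (intro that[of "A / b" "(B + a * (A / b)) / b"]) auto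
  qed
  have mn: "(- n, m) \<noteq> (0, 0)" using nz fac by auto
  have "P z \<longleftrightarrow> z \<in> {v, abs_proj_line (- n, m)}" for z
  proof -
    obtain W where W: "W \<noteq> (0, 0)" "z = abs_proj_line W" by (rule proj_line_cases)
    have "A * fst W ^ 2 + B * fst W * snd W + C * snd W ^ 2
        = (b * fst W - a * snd W) * (m * fst W + n * snd W)"
      unfolding fac by (simp add: algebra_simps power2_eq_square)
    then have "P z \<longleftrightarrow> b * fst W = a * snd W \<or> m * fst W + n * snd W = 0"
      using P W by simp
    moreover have "z = v \<longleftrightarrow> b * fst W = a * snd W"
      using V W by (auto simp: abs_proj_line_eq_iff a_def b_def ac_simps)
    moreover have "z = abs_proj_line (- n, m) \<longleftrightarrow> m * fst W + n * snd W = 0"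
      using mn W by (simp add: abs_proj_line_eq_iff)
        (simp add: eq_neg_iff_add_eq_0 ac_simps)
    ultimately show ?thesis by blast
  qed
  then show ?thesis by blast
qed


section \<open>Classes of functions\<close>

lemma fun_class_eqI:
  assumes "finite {p \<in> E. f p \<noteq> g p}"
  shows "fun_class E f = fun_class E g"
proof -
  have "finite {p \<in> E. h p \<noteq> g p}" if "finite {p \<in> E. h p \<noteq> f p}" for h
    by (rule finite_subset[OF _ finite_UnI[OF assms that]]) auto
  moreover have "finite {p \<in> E. h p \<noteq> f p}" if "finite {p \<in> E. h p \<noteq> g p}" for h
    by (rule finite_subset[OF _ finite_UnI[OF assms that]]) auto
  ultimately show ?thesis unfolding fun_class_def by blast
qed

lemma fun_class_self: "f \<in> fun_class E f"
  by (simp add: fun_class_def)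

lemma fun_class_eqD: "fun_class E f = fun_class E g \<Longrightarrow> finite {p \<in> E. f p \<noteq> g p}"
  using fun_class_self[of f E] by (simp add: fun_class_def)

text \<open>A pullback is defined as a union over all representatives; the union collapses once its
  value does not depend on the representative.\<close>

lemma Union_fun_class:
  assumes "\<And>f'. f' \<in> fun_class E f \<Longrightarrow> H f' = H f"
  shows "(\<Union>f'\<in>fun_class E f. H f') = H f"
  using assms fun_class_self[of f E] by blast

text \<open>A change of representatives affects the result only where one of the two functions
  changes, so every pointwise operation descends to classes, for arbitrary functions.\<close>

lemma fun_class_binop:
  fixes f g :: "point \<Rightarrow> complex" and op :: "complex \<Rightarrow> complex \<Rightarrow> complex"
  shows "(\<Union>f'\<in>fun_class E f. \<Union>g'\<in>fun_class E g. fun_class E (\<lambda>p. op (f' p) (g' p)))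
      = fun_class E (\<lambda>p. op (f p) (g p))"
proof -
  have "fun_class E (\<lambda>p. op (f' p) (g' p)) = fun_class E (\<lambda>p. op (f p) (g p))"
    if "f' \<in> fun_class E f" "g' \<in> fun_class E g" for f' g'
  proof (rule fun_class_eqI)
    have "finite ({p \<in> E. f' p \<noteq> f p} \<union> {p \<in> E. g' p \<noteq> g p})"
      using that by (simp add: fun_class_def)
    then show "finite {p \<in> E. op (f' p) (g' p) \<noteq> op (f p) (g p)}"
      by (rule rev_finite_subset) auto
  qed
  then show ?thesis using fun_class_self by blast
qed

lemma function_field_add:
  "fun_class E f \<oplus>\<^bsub>function_field E\<^esub> fun_class E g = fun_class E (\<lambda>p. f p + g p)"
  by (simp add: function_field_def fun_class_binop)

lemma function_field_mult:
  "fun_class E f \<otimes>\<^bsub>function_field E\<^esub> fun_class E g = fun_class E (\<lambda>p. f p * g p)"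
  by (simp add: function_field_def fun_class_binop)

lemma function_field_zero: "\<zero>\<^bsub>function_field E\<^esub> = fun_class E (\<lambda>_. 0)"
  by (simp add: function_field_def)

lemma carrier_function_fieldE:
  assumes "A \<in> carrier (function_field E)"
  obtains h where "A = fun_class E h"
  using assms by (auto simp: function_field_def)

text \<open>The additive inverse is a definite description over the carrier. It is evaluated
  directly, without ring axioms: the class of -g is a candidate by assumption, and any other
  candidate agrees with -g off a finite set.\<close>

lemma function_field_minus:
  assumes "fun_class E (\<lambda>p. - g p) \<in> carrier (function_field E)"
  shows "fun_class E f \<ominus>\<^bsub>function_field E\<^esub> fun_class E g = fun_class E (\<lambda>p. f p - g p)"
proof -
  have "\<ominus>\<^bsub>function_field E\<^esub> fun_class E g = fun_class E (\<lambda>p. - g p)"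
    unfolding a_inv_def m_inv_def
  proof (rule the_equality)
    fix A assume A: "A \<in> carrier (add_monoid (function_field E)) \<and>
        fun_class E g \<otimes>\<^bsub>add_monoid (function_field E)\<^esub> A = \<one>\<^bsub>add_monoid (function_field E)\<^esub> \<and>
        A \<otimes>\<^bsub>add_monoid (function_field E)\<^esub> fun_class E g = \<one>\<^bsub>add_monoid (function_field E)\<^esub>"
    then obtain h where h: "A = fun_class E h" by (auto elim: carrier_function_fieldE)
    then have "fun_class E (\<lambda>p. g p + h p) = fun_class E (\<lambda>_. 0)"
      using A by (simp add: function_field_add function_field_zero)
    then have "finite {p \<in> E. g p + h p \<noteq> 0}" by (rule fun_class_eqD)
    then have "finite {p \<in> E. h p \<noteq> - g p}" by (simp add: eq_neg_iff_add_eq_0 add.commute)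
    then show "A = fun_class E (\<lambda>p. - g p)" unfolding h by (rule fun_class_eqI)
  qed (use assms in \<open>simp add: function_field_add function_field_zero\<close>)
  then show ?thesis by (simp add: a_minus_def function_field_add)
qed

text \<open>Finite fibres of \<open>\<sigma>\<close> keep the preimage of a finite exceptional set
  finite, which makes composition independent of the representative.\<close>

lemma pullback_fun_class:
  assumes "\<And>q. finite {p \<in> E. \<sigma> p = q}" "\<sigma> \<in> E \<rightarrow> E"
  shows "pullback E \<sigma> (fun_class E f) = fun_class E (f \<circ> \<sigma>)"
  unfolding pullback_def
proof (rule Union_fun_class)
  fix f' assume f': "f' \<in> fun_class E f"
  have "{p \<in> E. (f' \<circ> \<sigma>) p \<noteq> (f \<circ> \<sigma>) p} \<subseteq> (\<Union>q\<in>{q \<in> E. f' q \<noteq> f q}. {p \<in> E. \<sigma> p = q})"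
    using assms(2) by auto
  then have "finite {p \<in> E. (f' \<circ> \<sigma>) p \<noteq> (f \<circ> \<sigma>) p}"
    by (rule finite_subset) (use f' assms(1) in \<open>auto simp: fun_class_def\<close>)
  then show "fun_class E (f' \<circ> \<sigma>) = fun_class E (f \<circ> \<sigma>)" by (rule fun_class_eqI)
qed


section \<open>Curves with two-point fibres\<close>

text \<open>These are the existence halves of the descriptions behind \<open>iota1\<close> and
  \<open>iota2\<close>; uniqueness is automatic, since p and the set {p, q} determine q.
  Ramification is the case q = p.\<close>

locale two_point_fibres =
  fixes E :: "point set"
  assumes fibre1: "p \<in> E \<Longrightarrow> \<exists>q. {r \<in> E. fst r = fst p} = {p, q}"
    and fibre2: "p \<in> E \<Longrightarrow> \<exists>q. {r \<in> E. snd r = snd p} = {p, q}"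
begin

lemma finite_fst_fibre: "finite {r \<in> E. fst r = u}"
proof (cases "\<exists>p\<in>E. fst p = u")
  case True
  then obtain p where p: "p \<in> E" "fst p = u" by blast
  then obtain q where "{r \<in> E. fst r = u} = {p, q}" using fibre1 by metis
  then show ?thesis by simp
next
  case False
  then have "{r \<in> E. fst r = u} = {}" by blast
  then show ?thesis by (simp only: finite.emptyI)
qed

lemma finite_snd_fibre: "finite {r \<in> E. snd r = v}"
proof (cases "\<exists>p\<in>E. snd p = v")
  case True
  then obtain p where p: "p \<in> E" "snd p = v" by blast
  then obtain q where "{r \<in> E. snd r = v} = {p, q}" using fibre2 by metis
  then show ?thesis by simp
next
  case False
  then have "{r \<in> E. snd r = v} = {}" by blast
  then show ?thesis by (simp only: finite.emptyI)
qed

lemma finite_over_fst: "finite {u. P u} \<Longrightarrow> finite {p \<in> E. P (fst p)}"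
  by (rule finite_subset[of _ "\<Union>u\<in>{u. P u}. {r \<in> E. fst r = u}"]) (auto simp: finite_fst_fibre)

lemma finite_over_snd: "finite {u. P u} \<Longrightarrow> finite {p \<in> E. P (snd p)}"
  by (rule finite_subset[of _ "\<Union>u\<in>{u. P u}. {r \<in> E. snd r = u}"]) (auto simp: finite_snd_fibre)

lemma iota1_fibre:
  assumes "p \<in> E"
  shows "{r \<in> E. fst r = fst p} = {p, iota1 E p}"
proof -
  have "\<exists>!q. {r \<in> E. fst r = fst p} = {p, q}"
    using fibre1[OF assms] by (metis doubleton_eq_iff)
  from theI'[OF this] show ?thesis using assms by (simp add: iota1_def)
qed

lemma iota2_fibre:
  assumes "p \<in> E"
  shows "{r \<in> E. snd r = snd p} = {p, iota2 E p}"
proof -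
  have "\<exists>!q. {r \<in> E. snd r = snd p} = {p, q}"
    using fibre2[OF assms] by (metis doubleton_eq_iff)
  from theI'[OF this] show ?thesis using assms by (simp add: iota2_def)
qed

lemma iota1_closed [simp]: "p \<in> E \<Longrightarrow> iota1 E p \<in> E"
  and fst_iota1 [simp]: "p \<in> E \<Longrightarrow> fst (iota1 E p) = fst p"
  using iota1_fibre by blast+

lemma iota2_closed [simp]: "p \<in> E \<Longrightarrow> iota2 E p \<in> E"
  and snd_iota2 [simp]: "p \<in> E \<Longrightarrow> snd (iota2 E p) = snd p"
  using iota2_fibre by blast+

lemma tau_eq: "p \<in> E \<Longrightarrow> tau E p = iota2 E (iota1 E p)"
  by (simp add: tau_def compose_def)

lemma tau_closed [simp]: "p \<in> E \<Longrightarrow> tau E p \<in> E"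
  by (simp add: tau_eq)

text \<open>A point lies in the same fibre of the first projection as its image, and that fibre is
  finite; injectivity of \<open>iota1\<close> does not enter.\<close>

lemma finite_iota1_vimage: "finite S \<Longrightarrow> finite {p \<in> E. iota1 E p \<in> S}"
  by (rule finite_subset[of _ "\<Union>q\<in>S. {r \<in> E. fst r = fst q}"]) (auto simp: finite_fst_fibre)

lemma finite_iota2_vimage: "finite S \<Longrightarrow> finite {p \<in> E. iota2 E p \<in> S}"
  by (rule finite_subset[of _ "\<Union>q\<in>S. {r \<in> E. snd r = snd q}"]) (auto simp: finite_snd_fibre)

lemma finite_tau_vimage: "finite S \<Longrightarrow> finite {p \<in> E. tau E p \<in> S}"
  by (rule finite_subset[OF _ finite_iota1_vimage[OF finite_iota2_vimage[of S]]])
    (auto simp: tau_eq)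

lemma pullback_iota1: "pullback E (iota1 E) (fun_class E f) = fun_class E (f \<circ> iota1 E)"
  by (rule pullback_fun_class) (use finite_iota1_vimage[of "{_}"] in auto)

lemma pullback_tau: "pullback E (tau E) (fun_class E f) = fun_class E (f \<circ> tau E)"
  by (rule pullback_fun_class) (use finite_tau_vimage[of "{_}"] in auto)

end

section \<open>Rational functions of one coordinate\<close>

lemma vanishes_abs:
  "U \<noteq> (0, 0) \<Longrightarrow> V \<noteq> (0, 0) \<Longrightarrow>
    vanishes m n a (abs_proj_line U) (abs_proj_line V) \<longleftrightarrow> biform m n a U V = 0"
  by (simp add: vanishes.abs_eq eq_onp_def proj_rel_refl)

lemma biquot_abs:
  "U \<noteq> (0, 0) \<Longrightarrow> V \<noteq> (0, 0) \<Longrightarrow>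
    biquot m n a b (abs_proj_line U) (abs_proj_line V) = biform m n a U V / biform m n b U V"
  by (simp add: biquot.abs_eq eq_onp_def proj_rel_refl)

lemma sum_coeff_poly:
  fixes P :: "complex poly"
  assumes "degree P \<le> m"
  shows "(\<Sum>i\<le>m. coeff P i * a ^ i) = poly P a"
  unfolding poly_altdef by (rule sum.mono_neutral_right) (use assms in \<open>auto simp: coeff_eq_0\<close>)

lemma biform_fst:
  assumes "degree P \<le> m"
  shows "biform m 0 (\<lambda>i _. coeff P i) (a, 1) V = poly P a"
  using sum_coeff_poly[OF assms] by (simp add: biform_def)

lemma biform_snd:
  assumes "degree P \<le> m"
  shows "biform 0 m (\<lambda>_ i. coeff P i) U (a, 1) = poly P a"
  using sum_coeff_poly[OF assms] by (simp add: biform_def)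

lemma finite_affine_poly_zeros:
  fixes Q :: "complex poly"
  assumes "Q \<noteq> 0"
  shows "finite {u. u = abs_proj_line (1, 0) \<or> poly Q (affine_coord u) = 0}"
  using finite_affine_coord_in[of "{a. poly Q a = 0}"] poly_roots_finite[OF assms]
  by (simp add: Collect_disj_eq)

context two_point_fibres
begin

text \<open>Homogenizing P and Q to the common degree m turns P(x)/Q(x) into a quotient of two forms
  of bidegree (m, 0).\<close>

lemma rational_fst_carrier:
  assumes "Q \<noteq> 0"
  shows "fun_class E (\<lambda>p. poly P (affine_coord (fst p)) / poly Q (affine_coord (fst p)))
    \<in> carrier (function_field E)"
proof -
  define m where "m = max (degree P) (degree Q)"
  have deg: "degree P \<le> m" "degree Q \<le> m" by (auto simp: m_def)
  let ?a = "\<lambda>i (_::nat). coeff P i" and ?b = "\<lambda>i (_::nat). coeff Q i"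
  \<comment> \<open>At infinity the quotient of forms may differ from the expression in the default
    coordinate 0. Off this finite set the two agree and the denominator is nonzero, which also
    bounds the zeros of the denominator.\<close>
  let ?bad = "{p \<in> E. fst p = abs_proj_line (1, 0) \<or> poly Q (affine_coord (fst p)) = 0}"
  have fin: "finite ?bad"
    by (rule finite_over_fst[OF finite_affine_poly_zeros[OF assms]])
  have good: "\<not> vanishes m 0 ?b (fst p) (snd p) \<and> biquot m 0 ?a ?b (fst p) (snd p) =
      poly P (affine_coord (fst p)) / poly Q (affine_coord (fst p))"
    if "p \<in> E" "p \<notin> ?bad" for p
  proof -
    obtain V where V: "V \<noteq> (0, 0)" "snd p = abs_proj_line V" by (rule proj_line_cases)
    have U: "fst p = abs_proj_line (affine_coord (fst p), 1)"
      using that eq_affine_point by blast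
    have "poly Q (affine_coord (fst p)) \<noteq> 0" using that by blast
    then show ?thesis
      unfolding V(2) by (subst (1 2) U) (simp add: V(1) vanishes_abs biquot_abs biform_fst deg)
  qed
  have "finite {p \<in> E. vanishes m 0 ?b (fst p) (snd p)}"
    by (rule finite_subset[OF _ fin]) (use good in blast)
  moreover have "fun_class E (\<lambda>p. poly P (affine_coord (fst p)) / poly Q (affine_coord (fst p)))
      = fun_class E (\<lambda>p. biquot m 0 ?a ?b (fst p) (snd p))"
    by (rule fun_class_eqI, rule finite_subset[OF _ fin]) (use good in force)
  ultimately show ?thesis unfolding function_field_def by (simp, blast)
qed

lemma rational_snd_carrier:
  assumes "Q \<noteq> 0"
  shows "fun_class E (\<lambda>p. poly P (affine_coord (snd p)) / poly Q (affine_coord (snd p)))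
    \<in> carrier (function_field E)"
proof -
  define m where "m = max (degree P) (degree Q)"
  have deg: "degree P \<le> m" "degree Q \<le> m" by (auto simp: m_def)
  let ?a = "\<lambda>(_::nat) i. coeff P i" and ?b = "\<lambda>(_::nat) i. coeff Q i"
  let ?bad = "{p \<in> E. snd p = abs_proj_line (1, 0) \<or> poly Q (affine_coord (snd p)) = 0}"
  have fin: "finite ?bad"
    by (rule finite_over_snd[OF finite_affine_poly_zeros[OF assms]])
  have good: "\<not> vanishes 0 m ?b (fst p) (snd p) \<and> biquot 0 m ?a ?b (fst p) (snd p) =
      poly P (affine_coord (snd p)) / poly Q (affine_coord (snd p))"
    if "p \<in> E" "p \<notin> ?bad" for p
  proof -
    obtain U where U: "U \<noteq> (0, 0)" "fst p = abs_proj_line U" by (rule proj_line_cases)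
    have V: "snd p = abs_proj_line (affine_coord (snd p), 1)"
      using that eq_affine_point by blast
    have "poly Q (affine_coord (snd p)) \<noteq> 0" using that by blast
    then show ?thesis
      unfolding U(2) by (subst (1 2) V) (simp add: U(1) vanishes_abs biquot_abs biform_snd deg)
  qed
  have "finite {p \<in> E. vanishes 0 m ?b (fst p) (snd p)}"
    by (rule finite_subset[OF _ fin]) (use good in blast)
  moreover have "fun_class E (\<lambda>p. poly P (affine_coord (snd p)) / poly Q (affine_coord (snd p)))
      = fun_class E (\<lambda>p. biquot 0 m ?a ?b (fst p) (snd p))"
    by (rule fun_class_eqI, rule finite_subset[OF _ fin]) (use good in force)
  ultimately show ?thesis unfolding function_field_def by (simp, blast)
qed

lemma minus_x_fun:
  "fun_class E f \<ominus>\<^bsub>function_field E\<^esub> x_fun E = fun_class E (\<lambda>p. f p - affine_coord (fst p))"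
  unfolding x_fun_def
  by (rule function_field_minus) (use rational_fst_carrier[of 1 "[:0, -1:]"] in simp)

lemma minus_y_fun:
  "fun_class E f \<ominus>\<^bsub>function_field E\<^esub> y_fun E = fun_class E (\<lambda>p. f p - affine_coord (snd p))"
  unfolding y_fun_def
  by (rule function_field_minus) (use rational_snd_carrier[of 1 "[:0, -1:]"] in simp)

lemma b1_eq:
  "b1 E = fun_class E (\<lambda>p. affine_coord (snd (iota1 E p)) *
      (affine_coord (fst (tau E p)) - affine_coord (fst p)))"
  by (simp add: b1_def minus_x_fun[unfolded x_fun_def] pullback_tau pullback_iota1
      function_field_mult x_fun_def y_fun_def)

lemma b2_eq:
  "b2 E = fun_class E (\<lambda>p. affine_coord (fst p) *
      (affine_coord (snd (iota1 E p)) - affine_coord (snd p)))"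
  by (simp add: b2_def minus_y_fun[unfolded y_fun_def] pullback_iota1 function_field_mult
      x_fun_def y_fun_def)

end

section \<open>Decoupling\<close>

text \<open>Equality in the function field is equality off a finite set, so finitely many exceptions
  are allowed; they absorb the default values at poles and at infinity.\<close>

locale decoupled_curve = two_point_fibres +
  fixes P1 Q1 P2 Q2 :: "complex poly"
  assumes Q_nonzero: "Q1 \<noteq> 0" "Q2 \<noteq> 0"
    and decoupled: "finite {p \<in> E. affine_coord (fst p) * affine_coord (snd p) \<noteq>
      poly P1 (affine_coord (fst p)) / poly Q1 (affine_coord (fst p)) +
      poly P2 (affine_coord (snd p)) / poly Q2 (affine_coord (snd p))}"
begin

text \<open>The witness is R1(x). The points \<open>iota1 E p\<close> and \<open>tau E p\<close>
  share their y, so subtracting the decoupling identities there cancels R2; moreover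
  \<open>iota1 E p\<close> and p share their x.\<close>

lemma b1_telescopes:
  "\<exists>g\<in>carrier (function_field E). b1 E = pullback E (tau E) g \<ominus>\<^bsub>function_field E\<^esub> g"
proof
  let ?R = "\<lambda>p. poly P1 (affine_coord (fst p)) / poly Q1 (affine_coord (fst p))"
  let ?S = "{p \<in> E. affine_coord (fst p) * affine_coord (snd p) \<noteq> ?R p +
      poly P2 (affine_coord (snd p)) / poly Q2 (affine_coord (snd p))}"
  show "fun_class E ?R \<in> carrier (function_field E)"
    by (rule rational_fst_carrier[OF Q_nonzero(1)])
  have neg: "fun_class E (\<lambda>p. - ?R p) \<in> carrier (function_field E)"
    using rational_fst_carrier[OF Q_nonzero(1), of "- P1"] by simp
  have eq: "affine_coord (snd (iota1 E p)) * (affine_coord (fst (tau E p)) - affine_coord (fst p))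
      = ?R (tau E p) - ?R p"
    if p: "p \<in> E" "iota1 E p \<notin> ?S" "tau E p \<notin> ?S" for p
  proof -
    define y where "y = affine_coord (snd (iota1 E p))"
    have y: "affine_coord (snd (tau E p)) = y" using p by (simp add: tau_eq y_def)
    have "affine_coord (fst (tau E p)) * y = ?R (tau E p) + poly P2 y / poly Q2 y"
      using p y by simp
    moreover have "affine_coord (fst p) * y = ?R p + poly P2 y / poly Q2 y"
      using p by (simp add: y_def)
    ultimately show ?thesis unfolding y_def[symmetric] by (simp add: algebra_simps)
  qed
  have "finite ({p \<in> E. iota1 E p \<in> ?S} \<union> {p \<in> E. tau E p \<in> ?S})"
    by (intro finite_UnI finite_iota1_vimage finite_tau_vimage decoupled)
  then show "b1 E = pullback E (tau E) (fun_class E ?R) \<ominus>\<^bsub>function_field E\<^esub> fun_class E ?R"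
    unfolding b1_eq pullback_tau function_field_minus[OF neg] o_def
    by (intro fun_class_eqI) (erule rev_finite_subset, use eq in blast)
qed

text \<open>The witness is R2(y). Here the identity is compared at p and \<open>iota1 E p\<close>,
  which share their x, so R1 cancels; y takes the same value at \<open>iota1 E p\<close> and
  \<open>tau E p\<close>.\<close>

lemma b2_telescopes:
  "\<exists>g\<in>carrier (function_field E). b2 E = pullback E (tau E) g \<ominus>\<^bsub>function_field E\<^esub> g"
proof
  let ?R = "\<lambda>p. poly P2 (affine_coord (snd p)) / poly Q2 (affine_coord (snd p))"
  let ?S = "{p \<in> E. affine_coord (fst p) * affine_coord (snd p) \<noteq>
      poly P1 (affine_coord (fst p)) / poly Q1 (affine_coord (fst p)) + ?R p}"
  show "fun_class E ?R \<in> carrier (function_field E)"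
    by (rule rational_snd_carrier[OF Q_nonzero(2)])
  have neg: "fun_class E (\<lambda>p. - ?R p) \<in> carrier (function_field E)"
    using rational_snd_carrier[OF Q_nonzero(2), of "- P2"] by simp
  have eq: "affine_coord (fst p) * (affine_coord (snd (iota1 E p)) - affine_coord (snd p))
      = ?R (tau E p) - ?R p"
    if p: "p \<in> E" "iota1 E p \<notin> ?S" "p \<notin> ?S" for p
  proof -
    define x where "x = affine_coord (fst p)"
    have "x * affine_coord (snd (iota1 E p)) = poly P1 x / poly Q1 x + ?R (iota1 E p)"
      using p by (simp add: x_def)
    moreover have "x * affine_coord (snd p) = poly P1 x / poly Q1 x + ?R p"
      using p by (simp add: x_def)
    moreover have "?R (tau E p) = ?R (iota1 E p)" using p by (simp add: tau_eq)
    ultimately show ?thesis unfolding x_def[symmetric] by (simp add: algebra_simps)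
  qed
  have "finite ({p \<in> E. iota1 E p \<in> ?S} \<union> ?S)"
    by (intro finite_UnI finite_iota1_vimage decoupled)
  then show "b2 E = pullback E (tau E) (fun_class E ?R) \<ominus>\<^bsub>function_field E\<^esub> fun_class E ?R"
    unfolding b2_eq pullback_tau function_field_minus[OF neg] o_def
    by (intro fun_class_eqI) (erule rev_finite_subset, use eq in blast)
qed

lemma zeroth_order_telescoper:
  fixes \<delta> :: "ratfun \<Rightarrow> ratfun"
  assumes "b \<in> {b1 E, b2 E}"
  defines "F \<equiv> function_field E"
  shows "\<exists>(n::nat) (c :: nat \<Rightarrow> complex). \<exists>g\<in>carrier F.
           (\<delta> ^^ n) b \<oplus>\<^bsub>F\<^esub> (\<Oplus>\<^bsub>F\<^esub>k\<in>{..<n}. const_fun E (c k) \<otimes>\<^bsub>F\<^esub> (\<delta> ^^ k) b)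
           = pullback E (tau E) g \<ominus>\<^bsub>F\<^esub> g"
proof -
  have "\<exists>g\<in>carrier F. b = pullback E (tau E) g \<ominus>\<^bsub>F\<^esub> g"
    using assms b1_telescopes b2_telescopes by blast
  moreover have "b \<oplus>\<^bsub>F\<^esub> \<zero>\<^bsub>F\<^esub> = b"
    using assms by (auto simp: b1_eq b2_eq function_field_add function_field_zero)
  \<comment> \<open>An empty \<open>finsum\<close> is a fold confined to the carrier; it returns its
    start value zero only once zero is known to lie there.\<close>
  moreover have "\<zero>\<^bsub>F\<^esub> \<in> carrier F"
    using rational_fst_carrier[of 1 0] by (simp add: F_def function_field_zero)
  then have "(\<Oplus>\<^bsub>F\<^esub>k\<in>{..<0}. f k) = \<zero>\<^bsub>F\<^esub>" for f :: "nat \<Rightarrow> ratfun"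
    by (simp add: finsum_def finprod_def)
  ultimately show ?thesis
    by (intro exI[of _ 0]) simp
qed

end

section \<open>The five curves\<close>

text \<open>The equation is read as a binary quadratic form in either coordinate. A coefficient
  triple that never vanishes means that no whole fibre of a projection of the ambient surface lies
  in the curve, which leaves at most two points in each.\<close>

lemma decoupled_curveI:
  fixes A B C A' B' C' :: "complex \<times> complex \<Rightarrow> complex"
  assumes eq2: "\<And>U V. U \<noteq> (0, 0) \<Longrightarrow> V \<noteq> (0, 0) \<Longrightarrow>
      (abs_proj_line U, abs_proj_line V) \<in> E \<longleftrightarrow>
      A U * fst V ^ 2 + B U * fst V * snd V + C U * snd V ^ 2 = 0"
    and eq1: "\<And>U V. A U * fst V ^ 2 + B U * fst V * snd V + C U * snd V ^ 2 =
      A' V * fst U ^ 2 + B' V * fst U * snd U + C' V * snd U ^ 2"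
    and nz2: "\<And>U. U \<noteq> (0, 0) \<Longrightarrow> A U \<noteq> 0 \<or> B U \<noteq> 0 \<or> C U \<noteq> 0"
    and nz1: "\<And>V. V \<noteq> (0, 0) \<Longrightarrow> A' V \<noteq> 0 \<or> B' V \<noteq> 0 \<or> C' V \<noteq> 0"
    and Q: "Q1 \<noteq> 0" "Q2 \<noteq> 0"
    and dec: "\<And>x y. x \<noteq> 0 \<Longrightarrow> y \<noteq> 0 \<Longrightarrow> poly Q1 x \<noteq> 0 \<Longrightarrow> poly Q2 y \<noteq> 0 \<Longrightarrow>
      A (x, 1) * y ^ 2 + B (x, 1) * y + C (x, 1) = 0 \<Longrightarrow>
      x * y = poly P1 x / poly Q1 x + poly P2 y / poly Q2 y"
  shows "decoupled_curve E P1 Q1 P2 Q2"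
proof -
  interpret two_point_fibres E
  proof
    fix p assume p: "p \<in> E"
    obtain u v where uv: "p = (u, v)" by (cases p)
    obtain U where U: "U \<noteq> (0, 0)" "u = abs_proj_line U" by (rule proj_line_cases)
    obtain V where V: "V \<noteq> (0, 0)" "v = abs_proj_line V" by (rule proj_line_cases)
    have "\<exists>w. {z. (u, z) \<in> E} = {v, w}"
      by (rule binary_quadratic_zeros[of _ "A U" "B U" "C U"]) (use p uv U eq2 nz2 in auto)
    then obtain w where w: "{z. (u, z) \<in> E} = {v, w}" ..
    have "{r \<in> E. fst r = fst p} = Pair u ` {z. (u, z) \<in> E}" using uv by force
    then show "\<exists>q. {r \<in> E. fst r = fst p} = {p, q}" using w uv by auto
    have "\<exists>w. {z. (z, v) \<in> E} = {u, w}"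
      by (rule binary_quadratic_zeros[of _ "A' V" "B' V" "C' V"])
        (use p uv V eq2 eq1 nz1 in auto)
    then obtain w' where w': "{z. (z, v) \<in> E} = {u, w'}" ..
    have "{r \<in> E. snd r = snd p} = (\<lambda>z. (z, v)) ` {z. (z, v) \<in> E}" using uv by force
    then show "\<exists>q. {r \<in> E. snd r = snd p} = {p, q}" using w' uv by auto
  qed
  show ?thesis
  proof
    \<comment> \<open>Removing the coordinate value 0 removes infinity too, so every remaining point
      has the form ((x : 1), (y : 1)) and \<open>dec\<close> applies to it.\<close>
    let ?X = "insert 0 {a. poly Q1 a = 0}" and ?Y = "insert 0 {a. poly Q2 a = 0}"
    have "finite ({p \<in> E. affine_coord (fst p) \<in> ?X} \<union> {p \<in> E. affine_coord (snd p) \<in> ?Y})"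
      using Q by (intro finite_UnI finite_over_fst finite_over_snd finite_affine_coord_in)
        (simp_all add: poly_roots_finite)
    moreover have "affine_coord (fst p) * affine_coord (snd p) =
      poly P1 (affine_coord (fst p)) / poly Q1 (affine_coord (fst p)) +
      poly P2 (affine_coord (snd p)) / poly Q2 (affine_coord (snd p))"
      if "p \<in> E" "affine_coord (fst p) \<notin> ?X" "affine_coord (snd p) \<notin> ?Y" for p
    proof (rule dec)
      have "p = (abs_proj_line (affine_coord (fst p), 1), abs_proj_line (affine_coord (snd p), 1))"
        using that by (simp add: prod_eq_iff flip: eq_affine_point_nonzero)
      then show "A (affine_coord (fst p), 1) * affine_coord (snd p) ^ 2 +
          B (affine_coord (fst p), 1) * affine_coord (snd p) + C (affine_coord (fst p), 1) = 0"
        using eq2[of "(affine_coord (fst p), 1)" "(affine_coord (snd p), 1)"] that(1) by simp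
    qed (use that in auto)
    ultimately show "finite {p \<in> E. affine_coord (fst p) * affine_coord (snd p) \<noteq>
      poly P1 (affine_coord (fst p)) / poly Q1 (affine_coord (fst p)) +
      poly P2 (affine_coord (snd p)) / poly Q2 (affine_coord (snd p))}"
      by (elim rev_finite_subset) blast
  qed (use Q in auto)
qed

lemma mem_curve_abs:
  assumes "U \<noteq> (0, 0)" "V \<noteq> (0, 0)"
  shows "(abs_proj_line U, abs_proj_line V) \<in> curve D t \<longleftrightarrow>
    fst U * snd U * fst V * snd V - complex_of_real t *
      (\<Sum>i\<le>2. \<Sum>j\<le>2. step_weight D (int i - 1) (int j - 1) *
        fst U ^ i * snd U ^ (2 - i) * fst V ^ j * snd V ^ (2 - j)) = 0"
  using assms by (simp add: curve_def on_curve.abs_eq eq_onp_def proj_rel_refl)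

text \<open>The affine equation x y = s (x y^2 + x^2 y + 1 + x), divided by s x, reads x y = (-1 -
  x)/x + (y/s - y^2). The forms \<open>A\<close>, \<open>B\<close>, \<open>C\<close> collect the
  powers of y, and \<open>A'\<close>, \<open>B'\<close>, \<open>C'\<close> those of x.\<close>

lemma decoupled_curve_1:
  assumes "t > 0"
  defines "s \<equiv> complex_of_real t"
  shows "decoupled_curve (curve {(0,1), (1,0), (-1,-1), (0,-1)} t)
    [:-1, -1:] [:0, 1:] [:0, 1 / s, -1:] 1"
proof (rule decoupled_curveI[where A = "\<lambda>W. - s * fst W * snd W"
      and B = "\<lambda>W. fst W * snd W - s * fst W ^ 2"
      and C = "\<lambda>W. - s * (snd W ^ 2 + fst W * snd W)"
      and A' = "\<lambda>W. - s * fst W * snd W"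
      and B' = "\<lambda>W. fst W * snd W - s * (fst W ^ 2 + snd W ^ 2)"
      and C' = "\<lambda>W. - s * snd W ^ 2"],
    goal_cases eq2 eq1 nz2 nz1 Q1 Q2 dec)
  case (eq2 U V)
  then show ?case
    \<comment> \<open>\<open>numeral_2_eq_2\<close> unfolds the double sum into nine monomials, from
      which \<open>step_weight\<close> selects those of the step set.\<close>
    by (simp add: mem_curve_abs step_weight_def numeral_2_eq_2 s_def algebra_simps)
next
  case (eq1 U V)
  show ?case by (simp add: algebra_simps power2_eq_square)
next
  case (nz2 U)
  then show ?case using assms by (auto simp: prod_eq_iff)
next
  case (nz1 V)
  then show ?case using assms by (auto simp: prod_eq_iff)
next
  case (dec x y)
  moreover have "s \<noteq> 0" using assms by simp
  ultimately show ?case by (simp add: field_simps power2_eq_square) algebra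
qed simp_all

lemma decoupled_curve_2:
  assumes "t > 0"
  defines "s \<equiv> complex_of_real t"
  shows "decoupled_curve (curve {(0,1), (1,0), (-1,-1), (1,-1)} t)
    [:-1, 0, -1:] [:0, 1:] [:0, 1 / s, -1:] 1"
proof (rule decoupled_curveI[where A = "\<lambda>W. - s * fst W * snd W"
      and B = "\<lambda>W. fst W * snd W - s * fst W ^ 2"
      and C = "\<lambda>W. - s * (snd W ^ 2 + fst W ^ 2)"
      and A' = "\<lambda>W. - s * (fst W * snd W + snd W ^ 2)"
      and B' = "\<lambda>W. fst W * snd W - s * fst W ^ 2"
      and C' = "\<lambda>W. - s * snd W ^ 2"],
    goal_cases eq2 eq1 nz2 nz1 Q1 Q2 dec)
  case (eq2 U V)
  then show ?case
    by (simp add: mem_curve_abs step_weight_def numeral_2_eq_2 s_def algebra_simps)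
next
  case (eq1 U V)
  show ?case by (simp add: algebra_simps power2_eq_square)
next
  case (nz2 U)
  then show ?case using assms by (auto simp: prod_eq_iff)
next
  case (nz1 V)
  then show ?case using assms by (auto simp: prod_eq_iff)
next
  case (dec x y)
  moreover have "s \<noteq> 0" using assms by simp
  ultimately show ?case by (simp add: field_simps power2_eq_square) algebra
qed simp_all

text \<open>With e = 1/s, the roots over x satisfy y1 + y2 = e - x - 1/x and y1 y2 = x. Hence R2(y)
  = 1/y + e y - y^2 satisfies R2(y1) - R2(y2) = x (y1 - y2), so x y - R2(y) depends on x alone; it
  equals R1(x) = 1/x^2 - e/x + 1 - x.\<close>

lemma decoupled_curve_3:
  assumes "t > 0"
  defines "s \<equiv> complex_of_real t"
  shows "decoupled_curve (curve {(0,1), (-1,0), (1,0), (1,-1)} t)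
    [:1, - 1 / s, 1, -1:] [:0, 0, 1:] [:1, 0, 1 / s, -1:] [:0, 1:]"
proof (rule decoupled_curveI[where A = "\<lambda>W. - s * fst W * snd W"
      and B = "\<lambda>W. fst W * snd W - s * (fst W ^ 2 + snd W ^ 2)"
      and C = "\<lambda>W. - s * fst W ^ 2"
      and A' = "\<lambda>W. - s * (fst W * snd W + snd W ^ 2)"
      and B' = "\<lambda>W. fst W * snd W - s * fst W ^ 2"
      and C' = "\<lambda>W. - s * fst W * snd W"],
    goal_cases eq2 eq1 nz2 nz1 Q1 Q2 dec)
  case (eq2 U V)
  then show ?case
    by (simp add: mem_curve_abs step_weight_def numeral_2_eq_2 s_def algebra_simps)
next
  case (eq1 U V)
  show ?case by (simp add: algebra_simps power2_eq_square)
next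
  case (nz2 U)
  then show ?case using assms by (auto simp: prod_eq_iff)
next
  case (nz1 V)
  then show ?case using assms by (auto simp: prod_eq_iff)
next
  case (dec x y)
  define e where "e = 1 / s"
  have "s \<noteq> 0" using assms by simp
  moreover have "x * y = s * (x ^ 2 + y + x ^ 2 * y + x * y ^ 2)"
    using dec by (simp add: algebra_simps power2_eq_square)
  ultimately have rel: "e * (x * y) = x ^ 2 + y + x ^ 2 * y + x * y ^ 2" by (simp add: e_def)
  define N1 N2 M1 M2 where "N1 = 1 - e * x + x ^ 2 - x ^ 3" and "N2 = 1 + e * y ^ 2 - y ^ 3"
    and "M1 = x ^ 2" and "M2 = y"
  \<comment> \<open>After clearing denominators, the claim is a multiple of the curve equation, with
    cofactor 1 - x y. Treating e as an indeterminate makes this a polynomial identity.\<close>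
  have "N1 * M2 + N2 * M1 - x * y * (M1 * M2) =
      (1 - x * y) * (x ^ 2 + y + x ^ 2 * y + x * y ^ 2 - e * (x * y))"
    unfolding N1_def N2_def M1_def M2_def
    by (simp add: algebra_simps power2_eq_square power3_eq_cube power4_eq_xxxx)
  then have "x * y * (M1 * M2) = N1 * M2 + N2 * M1" using rel by simp
  moreover have "M1 \<noteq> 0" "M2 \<noteq> 0" using dec by (simp_all add: M1_def M2_def power2_eq_square)
  ultimately have "x * y = N1 / M1 + N2 / M2" by (simp add: add_frac_eq eq_divide_eq)
  then show ?case unfolding N1_def N2_def M1_def M2_def e_def
    by (simp add: algebra_simps power2_eq_square power3_eq_cube power4_eq_xxxx)
qed simp_all

lemma decoupled_curve_4:
  assumes "t > 0"
  defines "s \<equiv> complex_of_real t"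
  shows "decoupled_curve (curve {(0,1), (1,0), (-1,-1), (0,-1), (1,-1)} t)
    [:-1, -1, -1:] [:0, 1:] [:0, 1 / s, -1:] 1"
proof (rule decoupled_curveI[where A = "\<lambda>W. - s * fst W * snd W"
      and B = "\<lambda>W. fst W * snd W - s * fst W ^ 2"
      and C = "\<lambda>W. - s * (snd W ^ 2 + fst W * snd W + fst W ^ 2)"
      and A' = "\<lambda>W. - s * (fst W * snd W + snd W ^ 2)"
      and B' = "\<lambda>W. fst W * snd W - s * (fst W ^ 2 + snd W ^ 2)"
      and C' = "\<lambda>W. - s * snd W ^ 2"],
    goal_cases eq2 eq1 nz2 nz1 Q1 Q2 dec)
  case (eq2 U V)
  then show ?case
    by (simp add: mem_curve_abs step_weight_def numeral_2_eq_2 s_def algebra_simps)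
next
  case (eq1 U V)
  show ?case by (simp add: algebra_simps power2_eq_square)
next
  case (nz2 U)
  then show ?case using assms by (auto simp: prod_eq_iff)
next
  case (nz1 V)
  then show ?case using assms by (auto simp: prod_eq_iff)
next
  case (dec x y)
  moreover have "s \<noteq> 0" using assms by simp
  ultimately show ?case by (simp add: field_simps power2_eq_square) algebra
qed simp_all

text \<open>With e = 1/s, now y1 + y2 = x (e - x)/(1 + x) and y1 y2 = x. The choice R2(y) = -1/y^2 +
  e/y + (1 + e) y - y^2 again gives R2(y1) - R2(y2) = x (y1 - y2), and R1(x) = -(1 + x^2)/x - (1 +
  e) x (e - x)/(1 + x)^2. The double pole at x = -1 reflects the pole of y1 + y2.\<close>

lemma decoupled_curve_5:
  assumes "t > 0"
  defines "s \<equiv> complex_of_real t"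
  shows "decoupled_curve (curve {(-1,1), (0,1), (1,0), (0,-1), (1,-1)} t)
    (- ([:1, 0, 1:] * [:1, 1:]^2) - [:0, 0, 1:] * [:1 / s, -1:] * [:1 + 1 / s:])
    ([:0, 1:] * [:1, 1:]^2)
    [:-1, 1 / s, 0, 1 + 1 / s, -1:] [:0, 0, 1:]"
proof (rule decoupled_curveI[where A = "\<lambda>W. - s * (snd W ^ 2 + fst W * snd W)"
      and B = "\<lambda>W. fst W * snd W - s * fst W ^ 2"
      and C = "\<lambda>W. - s * (fst W * snd W + fst W ^ 2)"
      and A' = "\<lambda>W. - s * (fst W * snd W + snd W ^ 2)"
      and B' = "\<lambda>W. fst W * snd W - s * (fst W ^ 2 + snd W ^ 2)"
      and C' = "\<lambda>W. - s * fst W ^ 2"],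
    goal_cases eq2 eq1 nz2 nz1 Q1 Q2 dec)
  case (eq2 U V)
  then show ?case
    by (simp add: mem_curve_abs step_weight_def numeral_2_eq_2 s_def algebra_simps)
next
  case (eq1 U V)
  show ?case by (simp add: algebra_simps power2_eq_square)
next
  case (nz2 U)
  \<comment> \<open>\<open>A\<close> and \<open>C\<close> share the factor x0 + x1. Where it
    vanishes, \<open>B\<close> is -(1 + s) x0^2, so 1 + s must be nonzero; this comes from
    positivity of the real number t.\<close>
  have "1 + s = complex_of_real (1 + t)" by (simp add: s_def)
  then have s: "s \<noteq> 0" "1 + s \<noteq> 0" using assms by (simp_all only: of_real_eq_0_iff)
  show ?case
  proof (cases "fst U = 0 \<or> fst U + snd U \<noteq> 0")
    case True
    then show ?thesis using nz2 s(1)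
      by (auto simp: prod_eq_iff distrib_left[symmetric] power2_eq_square add.commute)
  next
    case False
    then have "snd U = - fst U" by (simp add: eq_neg_iff_add_eq_0 add.commute)
    then have "fst U * snd U - s * fst U ^ 2 = - ((1 + s) * fst U ^ 2)"
      by (simp add: algebra_simps power2_eq_square)
    then show ?thesis using False s(2) by simp
  qed
next
  case (nz1 V)
  then show ?case using assms by (auto simp: prod_eq_iff)
next
  case (dec x y)
  define e where "e = 1 / s"
  have "s \<noteq> 0" using assms by simp
  moreover have "x * y = s * (x * (1 + x) + y ^ 2 * (1 + x) + x ^ 2 * y)"
    using dec by (simp add: algebra_simps power2_eq_square)
  ultimately have rel: "e * (x * y) = x * (1 + x) + y ^ 2 * (1 + x) + x ^ 2 * y" by (simp add: e_def)
  define N1 N2 M1 M2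
    where "N1 = - ((1 + x ^ 2) * (1 + x) ^ 2) - x ^ 2 * (e - x) * (1 + e)"
    and "N2 = - 1 + e * y + (1 + e) * y ^ 3 - y ^ 4"
    and "M1 = x * (1 + x) ^ 2" and "M2 = y ^ 2"
  \<comment> \<open>As for the third step set, the cleared identity is a multiple of the curve
    equation; the first factor on the right is the cofactor.\<close>
  have "N1 * M2 + N2 * M1 - x * y * (M1 * M2) =
      ((1 + e) * x * y - x * (1 + x) * y ^ 2 - (1 + x)) *
      (x * (1 + x) + y ^ 2 * (1 + x) + x ^ 2 * y - e * (x * y))"
    unfolding N1_def N2_def M1_def M2_def
    by (simp add: algebra_simps power2_eq_square power3_eq_cube power4_eq_xxxx)
  then have "x * y * (M1 * M2) = N1 * M2 + N2 * M1" using rel by simp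
  moreover have "M1 \<noteq> 0" "M2 \<noteq> 0" using dec by (simp_all add: M1_def M2_def)
  ultimately have "x * y = N1 / M1 + N2 / M2" by (simp add: add_frac_eq eq_divide_eq)
  then show ?case unfolding N1_def N2_def M1_def M2_def e_def
    by (simp add: algebra_simps power2_eq_square power3_eq_cube power4_eq_xxxx
        add_divide_distrib)
qed simp_all

theorem theorem6p6:
  fixes D :: "(int \<times> int) set" and t :: real
    and E :: "point set" and F :: "ratfun ring"
    and \<Omega> :: "(ratfun \<Rightarrow> ratfun) \<Rightarrow> ratfun" and \<delta> :: "ratfun \<Rightarrow> ratfun"
  assumes "D \<in> {{(0,1), (1,0), (-1,-1), (0,-1)},
                 {(0,1), (1,0), (-1,-1), (1,-1)},
                 {(0,1), (-1,0), (1,0), (1,-1)},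
                 {(0,1), (1,0), (-1,-1), (0,-1), (1,-1)},
                 {(-1,1), (0,1), (1,0), (0,-1), (1,-1)}}"
    and "0 < t" and "t < 1 / real (card D)" and "\<not> algebraic t"
    and "E = curve D t" and "F = function_field E"
    and "infinite (walk_group E)"
    and "\<Omega> \<in> regular_differentials E" and "\<Omega> \<noteq> zero_diff E"
    and "\<delta> \<in> derivations E"
    and "\<forall>f\<in>carrier F. exact_diff E f = scale_diff E (\<delta> f) \<Omega>"
  shows "\<forall>b\<in>{b1 E, b2 E}. \<exists>(n::nat) (c :: nat \<Rightarrow> complex). \<exists>g\<in>carrier F.
           (\<delta> ^^ n) b \<oplus>\<^bsub>F\<^esub> (\<Oplus>\<^bsub>F\<^esub>k\<in>{..<n}. const_fun E (c k) \<otimes>\<^bsub>F\<^esub> (\<delta> ^^ k) b)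
           = pullback E (tau E) g \<ominus>\<^bsub>F\<^esub> g"
proof
  fix b assume b: "b \<in> {b1 E, b2 E}"
  obtain P1 Q1 P2 Q2 where "decoupled_curve E P1 Q1 P2 Q2"
    using assms(1,2,5) decoupled_curve_1 decoupled_curve_2 decoupled_curve_3 decoupled_curve_4
      decoupled_curve_5 by blast
  then show "\<exists>(n::nat) (c :: nat \<Rightarrow> complex). \<exists>g\<in>carrier F.
           (\<delta> ^^ n) b \<oplus>\<^bsub>F\<^esub> (\<Oplus>\<^bsub>F\<^esub>k\<in>{..<n}. const_fun E (c k) \<otimes>\<^bsub>F\<^esub> (\<delta> ^^ k) b)
           = pullback E (tau E) g \<ominus>\<^bsub>F\<^esub> g"
    unfolding assms(6) using b by (rule decoupled_curve.zeroth_order_telescoper)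
qed

end
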